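(* Let $q=p^{2s}$, where $p$ is an odd prime and $s$ is a positive integer. For every integer $e$ with $1\leq e\leq s$, there exists a $q$-ary MDS self-dual code of length $p^{2e}+1$.
   Context: $\mathbb{F}_q$ denotes the finite field with $q$ elements. A $q$-ary $[n,k,d]$ code is an $\mathbb{F}_q$-linear subspace $C\subseteq\mathbb{F}_q^n$ of dimension $k$ with minimum (Hamming) distance $d$; $n$ is its length. It is called MDS (maximum distance separable) if $k+d=n+1$. The dual $C^{\perp}$ is the orthogonal complement of $C$ in $\mathbb{F}_q^n$ with respect to the standard Euclidean bilinear form $\langle x,y\rangle=\sum_{i=1}^n x_iy_i$, and $C$ is self-dual if $C=C^{\perp}$. An MDS self-dual code of length $n$ thus has parameters $[n,\frac n2,\frac n2+1]$. *)

theory Defs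
  imports "Jordan_Normal_Form.VS_Connect" "HOL-Library.Cardinality"
begin

definition hamming_dist :: "'a vec \<Rightarrow> 'a vec \<Rightarrow> nat" where
  "hamming_dist x y = card {i. i < dim_vec x \<and> x $ i \<noteq> y $ i}"

(* Only meaningful for a code with at least two words; linear_code demands this. *)
definition min_dist :: "'a vec set \<Rightarrow> nat" where
  "min_dist C = Min {hamming_dist x y | x y. x \<in> C \<and> y \<in> C \<and> x \<noteq> y}"

definition linear_code :: "nat \<Rightarrow> nat \<Rightarrow> nat \<Rightarrow> 'a::field vec set \<Rightarrow> bool" where
  "linear_code n k d C \<longleftrightarrow>
     VectorSpace.subspace class_ring C (module_vec TYPE('a) n) \<and>
     vectorspace.dim class_ring ((module_vec TYPE('a) n)\<lparr>carrier := C\<rparr>) = k \<and>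
     (\<exists>x\<in>C. \<exists>y\<in>C. x \<noteq> y) \<and>
     min_dist C = d"

definition mds_code :: "nat \<Rightarrow> 'a::field vec set \<Rightarrow> bool" where
  "mds_code n C \<longleftrightarrow> (\<exists>k d. linear_code n k d C \<and> k + d = n + 1)"

definition self_dual_code :: "nat \<Rightarrow> 'a::field vec set \<Rightarrow> bool" where
  "self_dual_code n C \<longleftrightarrow> C = vec_module.orthogonal_complement n C"

end

(* Take as evaluation set an additive subgroup U of order N = p^(2e) of the field. Since U is
   closed under differences, the product of x - y over y in U, y \<noteq> x, does not depend on x:
   it is the product d of the nonzero elements of U. By Lagrange interpolation the sum of a
   polynomial h of degree < N over U is d times the coefficient of h at N - 1. As q = 1 mod 4,
   -1 is a square, so pairing x with -x shows that -d = w^2 for some w. The words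
   ((f(x))_{x in U}, w f_m) with deg f \<le> m = (N - 1)/2 therefore form a self-orthogonal
   code; it is MDS because f has at most deg f roots. A word orthogonal to the code is
   interpolated by some g of degree < N, and testing against monomials bounds deg g by m, so no
   dimension count is needed for self-duality. *)
theory Submission
  imports Defs "HOL-Algebra.Sylow"
begin

subsection \<open>Finite fields\<close>

text \<open>Multiplication by \<open>x\<close> permutes the nonzero elements, so their product is
  unchanged when every factor is scaled by \<open>x\<close>.\<close>

lemma finite_field_power_card_minus_one:
  fixes x :: "'a::{field,finite}"
  assumes "x \<noteq> 0"
  shows "x ^ (CARD('a) - 1) = 1"
proof -
  let ?A = "UNIV - {0::'a}"
  have "bij_betw ((*) x) ?A ?A"
    using assms by (intro bij_betw_byWitness[where f' = "\<lambda>y. y / x"]) auto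
  then have "(\<Prod>y\<in>?A. x * y) = \<Prod>?A"
    by (rule prod.reindex_bij_betw)
  then have "x ^ card ?A * \<Prod>?A = \<Prod>?A"
    by (simp add: prod.distrib)
  moreover have "\<Prod>?A \<noteq> 0" by simp
  ultimately show ?thesis by (simp add: card_Diff_singleton)
qed

text \<open>Translation by 1 permutes the field, so adding 1 to every summand leaves the sum of all
  elements unchanged.\<close>

lemma of_nat_CARD_eq_0: "of_nat CARD('a::{field,finite}) = (0::'a)"
proof -
  have "bij_betw (\<lambda>x::'a. x + 1) UNIV UNIV"
    by (intro bij_betw_byWitness[where f' = "\<lambda>y. y - 1"]) auto
  then have "(\<Sum>x\<in>UNIV. x + (1::'a)) = \<Sum>UNIV"
    by (rule sum.reindex_bij_betw)
  then show ?thesis by (simp add: sum.distrib)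
qed

lemma two_neq_0_if_odd_CARD:
  assumes "odd CARD('a::{field,finite})"
  shows "(2::'a) \<noteq> 0"
proof
  assume two: "(2::'a) = 0"
  obtain t where "CARD('a) = 2 * t + 1" using assms by (auto elim: oddE)
  then have "of_nat CARD('a) = (2 * of_nat t + 1 :: 'a)"
    by (metis of_nat_1 of_nat_add of_nat_mult of_nat_numeral)
  with two show False by (simp add: of_nat_CARD_eq_0)
qed

text \<open>With \<open>4 * t\<close> nonzero elements, not all of them can be roots of
  \<open>x ^ (2 * t) - 1\<close>. For a non-root \<open>g\<close>, the power
  \<open>g ^ (2 * t)\<close> squares to 1 without being 1, hence is -1, and \<open>g ^ t\<close> is
  the desired root.\<close>

lemma ex_sqrt_minus_one:
  assumes "CARD('a::{field,finite}) mod 4 = 1"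
  shows "\<exists>i::'a. i\<^sup>2 = -1"
proof -
  obtain t where t: "CARD('a) = 4 * t + 1"
    using assms by (metis div_mult_mod_eq mult.commute)
  have "CARD('a) > 1"
    using card_mono[of UNIV "{0, 1::'a}"] by simp
  with t have "t > 0" by simp
  have "\<exists>g::'a. g \<noteq> 0 \<and> g ^ (2 * t) \<noteq> 1"
  proof (rule ccontr)
    assume *: "\<not> ?thesis"
    let ?p = "monom 1 (2 * t) - 1 :: 'a poly"
    have deg: "degree ?p \<le> 2 * t"
      by (intro degree_diff_le) (simp_all add: degree_monom_le)
    have "coeff ?p (2 * t) = 1" using \<open>t > 0\<close> by simp
    then have "?p \<noteq> 0" by (metis coeff_0 zero_neq_one)
    then have "card {x. poly ?p x = 0} \<le> degree ?p"
      by (rule card_poly_roots_bound)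
    moreover have "UNIV - {0} \<subseteq> {x. poly ?p x = 0}"
      using * by (auto simp: poly_monom)
    then have "card (UNIV - {0::'a}) \<le> card {x. poly ?p x = 0}"
      by (intro card_mono) auto
    ultimately show False using deg t \<open>t > 0\<close> by (simp add: card_Diff_singleton)
  qed
  then obtain g :: 'a where g: "g \<noteq> 0" "g ^ (2 * t) \<noteq> 1" by blast
  have "(g ^ (2 * t))\<^sup>2 = 1"
    using finite_field_power_card_minus_one[OF g(1)] t
    by (simp flip: power_mult add: mult.commute)
  with g(2) have "g ^ (2 * t) = -1" by (simp add: power2_eq_1_iff)
  then show ?thesis by (metis power_mult mult.commute)
qed

text \<open>A pair \<open>x\<close>, \<open>-x\<close> contributes
  \<open>- x\<^sup>2 = (i * x)\<^sup>2\<close>. Since 2 is nonzero the two elements are distinct, so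
  such pairs can be removed one after another.\<close>

lemma prod_symmetric_set_is_square:
  fixes A :: "'a::field set"
  assumes "(2::'a) \<noteq> 0" and i: "i\<^sup>2 = (-1::'a)"
    and "finite A" "0 \<notin> A" "\<And>x. x \<in> A \<Longrightarrow> -x \<in> A"
  shows "\<exists>w. w\<^sup>2 = \<Prod>A"
  using assms(3-)
proof (induction A rule: finite_psubset_induct)
  case (psubset A)
  show ?case
  proof (cases "A = {}")
    case True
    then show ?thesis by (auto intro: exI[of _ 1])
  next
    case False
    then obtain x where x: "x \<in> A" by blast
    then have "x \<noteq> 0" using psubset.prems by auto
    then have ne: "-x \<noteq> x"
      using assms(1) by (metis add.right_inverse mult_2 mult_eq_0_iff)
    let ?B = "A - {x, -x}"
    have "\<exists>w. w\<^sup>2 = \<Prod>?B"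
    proof (rule psubset.IH)
      show "-y \<in> ?B" if "y \<in> ?B" for y
        using that psubset.prems(2) by auto
    qed (use x psubset.prems in auto)
    then obtain w where w: "w\<^sup>2 = \<Prod>?B" ..
    have A: "A = insert x (insert (-x) ?B)" using x psubset.prems by auto
    have "\<Prod>A = x * (-x * \<Prod>?B)"
      using psubset.hyps ne by (subst A, subst prod.insert) auto
    also have "\<dots> = i\<^sup>2 * x\<^sup>2 * w\<^sup>2"
      unfolding w i by (simp add: power2_eq_square)
    also have "\<dots> = (i * x * w)\<^sup>2"
      by (simp add: power_mult_distrib)
    finally show ?thesis by metis
  qed
qed

text \<open>The additive group is recast as a monoid record so that Sylow's theorem applies. The
  form used does not ask the cofactor \<open>p ^ (r - m)\<close> to be coprime to \<open>p\<close>,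
  so every exponent up to \<open>r\<close> is reached.\<close>

lemma ex_additive_subgroup:
  assumes "prime p" and "CARD('a::{ab_group_add,finite}) = p ^ r" and "m \<le> r"
  shows "\<exists>U::'a set. (\<forall>x\<in>U. \<forall>y\<in>U. x - y \<in> U) \<and> card U = p ^ m"
proof -
  let ?G = "\<lparr>carrier = UNIV :: 'a set, monoid.mult = (+), one = 0\<rparr>"
  have G: "group ?G"
    by (rule groupI) (auto simp: add.assoc intro: exI[of _ "- _"] left_minus)
  have "Coset.order ?G = p ^ m * p ^ (r - m)"
    using assms by (simp add: Coset.order_def flip: power_add)
  with sylow_thm[OF assms(1) G] obtain U where U: "subgroup U ?G" "card U = p ^ m"
    by auto
  have inv: "inv\<^bsub>?G\<^esub> y = -y" for y
    using group.inv_equality[OF G, of "-y" y] by simp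
  have "x - y \<in> U" if "x \<in> U" "y \<in> U" for x y
    using subgroup.m_closed[OF U(1) that(1) subgroup.m_inv_closed[OF U(1) that(2)]]
    by (simp add: inv)
  with U(2) show ?thesis by blast
qed

subsection \<open>Lagrange interpolation\<close>

definition lagrange :: "'a::field set \<Rightarrow> ('a \<Rightarrow> 'a) \<Rightarrow> 'a poly" where
  "lagrange A y =
     (\<Sum>a\<in>A. Polynomial.smult (y a / (\<Prod>b\<in>A-{a}. a - b)) (\<Prod>b\<in>A-{a}. [:-b, 1:]))"

lemma degree_prod_linear: "degree (\<Prod>b\<in>B. [:-b, 1::'a::field:]) = card B"
  by (subst degree_prod_eq_sum_degree) auto

lemma coeff_prod_linear_card: "coeff (\<Prod>b\<in>B. [:-b, 1::'a::field:]) (card B) = 1"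
  using lead_coeff_prod[of "\<lambda>b. [:-b, 1::'a:]" B] by (simp add: degree_prod_linear)

lemma degree_lagrange: "degree (lagrange A y) \<le> card A - 1"
  unfolding lagrange_def
proof (cases "finite A")
  case True
  show "degree (\<Sum>a\<in>A. Polynomial.smult (y a / (\<Prod>b\<in>A-{a}. a - b)) (\<Prod>b\<in>A-{a}. [:-b, 1:]))
      \<le> card A - 1"
  proof (rule degree_sum_le[OF True])
    fix a assume "a \<in> A"
    then show "degree (Polynomial.smult (y a / (\<Prod>b\<in>A-{a}. a - b)) (\<Prod>b\<in>A-{a}. [:-b, 1:])) \<le> card A - 1"
      by (intro order.trans[OF degree_smult_le]) (simp add: degree_prod_linear True)
  qed
\<comment> \<open>A sum over an infinite set is 0 by convention, so the polynomial is 0 in this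
  case.\<close>
qed auto

lemma poly_lagrange:
  assumes "finite A" "a \<in> A"
  shows "poly (lagrange A y) a = y a"
proof -
  have "poly (lagrange A y) a =
      (\<Sum>c\<in>A. y c / (\<Prod>b\<in>A-{c}. c - b) * (\<Prod>b\<in>A-{c}. a - b))"
    by (simp add: lagrange_def poly_sum poly_prod)
  also have "\<dots> = (\<Sum>c\<in>A. if c = a then y a else 0)"
  proof (rule sum.cong[OF refl])
    fix c assume "c \<in> A"
    show "y c / (\<Prod>b\<in>A-{c}. c - b) * (\<Prod>b\<in>A-{c}. a - b) = (if c = a then y a else 0)"
    proof (cases "c = a")
      case True
      have "(\<Prod>b\<in>A-{a}. a - b) \<noteq> 0" using assms by auto
      with True show ?thesis by simp
    next
      case False
      then have "(\<Prod>b\<in>A-{c}. a - b) = 0" using assms by (intro prod_zero) auto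
      with False show ?thesis by simp
    qed
  qed
  also have "\<dots> = y a" using assms by simp
  finally show ?thesis .
qed

text \<open>Each numerator is monic of degree \<open>card A - 1\<close>, so only the scalar weights
  remain in the top coefficient.\<close>

lemma coeff_lagrange:
  assumes "finite A"
  shows "coeff (lagrange A y) (card A - 1) = (\<Sum>a\<in>A. y a / (\<Prod>b\<in>A-{a}. a - b))"
proof -
  have "coeff (\<Prod>b\<in>A-{a}. [:-b, 1:]) (card A - 1) = 1" if "a \<in> A" for a
    using coeff_prod_linear_card[of "A - {a}"] that assms by simp
  then show ?thesis by (simp add: lagrange_def coeff_sum)
qed

lemma lagrange_poly:
  assumes "finite A" "degree h < card A"
  shows "lagrange A (poly h) = h"
proof (rule poly_eqI_degree)
  show "degree (lagrange A (poly h)) < card A"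
    using degree_lagrange[of A "poly h"] assms(2) by linarith
qed (use assms poly_lagrange in auto)

subsection \<open>Images of injective linear maps\<close>

text \<open>Rank-nullity with trivial kernel; this supplies the dimension of the code once it is
  presented as the image of an injective encoder.\<close>

lemma subspace_and_dim_image:
  assumes "linear_map class_ring (module_vec TYPE('a::field) k) (module_vec TYPE('a) n) T"
    and "inj_on T (carrier_vec k)"
  shows "VectorSpace.subspace class_ring (T ` carrier_vec k) (module_vec TYPE('a) n)"
    and "vectorspace.dim class_ring ((module_vec TYPE('a) n)\<lparr>carrier := T ` carrier_vec k\<rparr>) = k"
proof -
  interpret linear_map class_ring "module_vec TYPE('a) k" "module_vec TYPE('a) n" T
    by fact
  interpret D: vec_space "TYPE('a)" k .
  have im: "im = T ` carrier_vec k"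
    by (simp add: im_def module_vec_simps)
  show "VectorSpace.subspace class_ring (T ` carrier_vec k) (module_vec TYPE('a) n)"
    using imT_is_subspace by (simp add: im)
  have "vectorspace.dim class_ring (V.vs kerT) = 0"
    using assms(2) by (intro inj_imp_dim_ker0) (simp add: module_vec_simps)
  then have "vectorspace.dim class_ring (W.vs imT) = k"
    using rank_nullity[OF D.fin_dim] D.dim_is_n by simp
  then show "vectorspace.dim class_ring ((module_vec TYPE('a) n)\<lparr>carrier := T ` carrier_vec k\<rparr>) = k"
    by (simp add: im)
qed

subsection \<open>Extended Reed--Solomon codes\<close>

text \<open>The last coordinate plays the role of evaluation at infinity. The condition on \<open>w\<close>
  turns the Lagrange formula for the top coefficient of a product of two message polynomials
  into orthogonality of their codewords.\<close>

locale extended_rs =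
  fixes U :: "'a::field set" and a :: "nat \<Rightarrow> 'a" and m :: nat and w :: 'a
  assumes bij: "bij_betw a {..<Suc (2 * m)} U"
    and diff_prod: "x \<in> U \<Longrightarrow> (\<Prod>y\<in>U-{x}. x - y) = - w\<^sup>2"
begin

definition codeword :: "'a poly \<Rightarrow> 'a vec" where
  "codeword f = vec (2 * m + 2) (\<lambda>i. if i < Suc (2 * m) then poly f (a i) else w * coeff f m)"

definition code :: "'a vec set" where
  "code = codeword ` {f. degree f \<le> m}"

lemma finite_U: "finite U" and card_U: "card U = Suc (2 * m)"
  using bij bij_betw_finite bij_betw_same_card[OF bij] by auto

lemma a_in_U: "i < Suc (2 * m) \<Longrightarrow> a i \<in> U"
  using bij bij_betwE by fastforce

lemma a_eq_iff: "i < Suc (2 * m) \<Longrightarrow> j < Suc (2 * m) \<Longrightarrow> a i = a j \<longleftrightarrow> i = j"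
  using bij by (auto simp: bij_betw_def inj_on_def)

lemma w_neq_0: "w \<noteq> 0"
proof
  assume "w = 0"
  then have "(\<Prod>y\<in>U-{a 0}. a 0 - y) = 0" using diff_prod[of "a 0"] a_in_U[of 0] by simp
  then show False using finite_U by simp
qed

text \<open>A polynomial of degree below \<open>card U\<close> is its own interpolant, and by
  \<open>diff_prod\<close> all Lagrange denominators equal \<open>- w\<^sup>2\<close>, so the
  formula for the top coefficient becomes a plain sum of values.\<close>

lemma sum_poly_U:
  assumes "degree h \<le> 2 * m"
  shows "(\<Sum>x\<in>U. poly h x) = - w\<^sup>2 * coeff h (2 * m)"
proof -
  have "coeff h (2 * m) = coeff (lagrange U (poly h)) (card U - 1)"
    using assms by (simp add: lagrange_poly finite_U card_U)
  also have "\<dots> = (\<Sum>x\<in>U. poly h x / - w\<^sup>2)"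
    unfolding coeff_lagrange[OF finite_U] by (intro sum.cong) (simp_all only: diff_prod)
  finally show ?thesis
    using w_neq_0 by (simp add: sum_negf flip: sum_divide_distrib)
qed

lemma scalar_prod_codeword_right:
  assumes "dim_vec v = 2 * m + 2"
  shows "v \<bullet> codeword f = (\<Sum>i<Suc (2 * m). v $ i * poly f (a i)) + v $ Suc (2 * m) * (w * coeff f m)"
proof -
  have "v \<bullet> codeword f = (\<Sum>i\<in>{..<Suc (Suc (2 * m))}. v $ i * codeword f $ i)"
    by (simp add: scalar_prod_def codeword_def atLeast0LessThan)
  also have "\<dots> = (\<Sum>i<Suc (2 * m). v $ i * codeword f $ i)
      + v $ Suc (2 * m) * codeword f $ Suc (2 * m)"
    by (rule sum.lessThan_Suc)
  also have "(\<Sum>i<Suc (2 * m). v $ i * codeword f $ i) = (\<Sum>i<Suc (2 * m). v $ i * poly f (a i))"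
    by (intro sum.cong) (auto simp: codeword_def)
  finally show ?thesis by (simp add: codeword_def)
qed

lemma sum_index_eq: "(\<Sum>i<Suc (2 * m). g (a i)) = sum g U"
  by (rule sum.reindex_bij_betw[OF bij])

section \<open>Self-duality\<close>

text \<open>The evaluation part sums to \<open>- w\<^sup>2 * coeff f m * coeff g m\<close>, which
  the product of the two last coordinates cancels.\<close>

lemma code_self_orthogonal:
  assumes "degree f \<le> m" "degree g \<le> m"
  shows "codeword f \<bullet> codeword g = 0"
proof -
  have "codeword f \<bullet> codeword g =
      (\<Sum>i<Suc (2 * m). poly f (a i) * poly g (a i)) + w * coeff f m * (w * coeff g m)"
    by (subst scalar_prod_codeword_right) (simp_all add: codeword_def)
  also have "(\<Sum>i<Suc (2 * m). poly f (a i) * poly g (a i)) = (\<Sum>x\<in>U. poly (f * g) x)"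
    by (subst sum_index_eq) simp
  also have "\<dots> = - w\<^sup>2 * coeff (f * g) (2 * m)"
    using assms degree_mult_le[of f g] by (intro sum_poly_U) linarith
  \<comment> \<open>If either degree is below \<open>m\<close>, both sides vanish.\<close>
  also have "coeff (f * g) (2 * m) = coeff f m * coeff g m"
  proof (cases "degree f = m \<and> degree g = m")
    case True
    then show ?thesis using coeff_mult_degree_sum[of f g] by (simp add: mult_2)
  next
    case False
    with assms have "degree f < m \<or> degree g < m" by auto
    moreover from False assms have "degree (f * g) < 2 * m"
      using degree_mult_le[of f g] by linarith
    ultimately show ?thesis by (auto simp: coeff_eq_0)
  qed
  finally show ?thesis by (simp add: power2_eq_square algebra_simps)
qed

lemma orthogonal_in_code:
  assumes dim: "dim_vec v = 2 * m + 2"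
    and orth: "\<And>f. degree f \<le> m \<Longrightarrow> v \<bullet> codeword f = 0"
  shows "v \<in> code"
proof -
  \<comment> \<open>\<open>g\<close> interpolates all coordinates of \<open>v\<close> but the last;
    the inverse of \<open>a\<close> translates points back to positions.\<close>
  define g where "g = lagrange U (\<lambda>x. v $ (inv_into {..<Suc (2 * m)} a x))"
  have deg_g: "degree g \<le> 2 * m"
    using degree_lagrange[of U] by (simp add: g_def card_U)
  have poly_g: "poly g (a i) = v $ i" if "i < Suc (2 * m)" for i
    using that bij by (simp add: g_def poly_lagrange finite_U a_in_U bij_betw_inv_into_left)
  have key: "(\<Sum>x\<in>U. poly (g * f) x) + v $ Suc (2 * m) * (w * coeff f m) = 0"
    if "degree f \<le> m" for f
  proof -
    have "(\<Sum>x\<in>U. poly (g * f) x) = (\<Sum>i<Suc (2 * m). v $ i * poly f (a i))"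
      by (subst sum_index_eq[symmetric]) (simp add: poly_g)
    then show ?thesis
      using orth[OF that] scalar_prod_codeword_right[OF dim, of f] by simp
  qed
  have "degree g \<le> m"
  proof (rule ccontr)
    assume "\<not> degree g \<le> m"
    \<comment> \<open>The monomial of degree \<open>j\<close> lifts the leading term of
      \<open>g\<close> exactly to degree \<open>2 * m\<close>, where \<open>sum_poly_U\<close>
      detects it. As \<open>j < m\<close>, the last coordinate of its codeword is 0 and does not
      interfere.\<close>
    define j where "j = 2 * m - degree g"
    have j: "j < m" "degree g + j = 2 * m"
      using \<open>\<not> degree g \<le> m\<close> deg_g by (auto simp: j_def)
    have "degree (g * monom 1 j) \<le> 2 * m"
      using degree_mult_le[of g "monom 1 j"] j degree_monom_le[of "1::'a" j] by linarith
    then have "(\<Sum>x\<in>U. poly (g * monom 1 j) x) = - w\<^sup>2 * coeff (g * monom 1 j) (2 * m)"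
      by (rule sum_poly_U)
    also have "coeff (g * monom 1 j) (2 * m) = lead_coeff g"
      using coeff_mult_degree_sum[of g "monom 1 j"] j by (simp add: degree_monom_eq)
    finally have "lead_coeff g = 0"
      using key[of "monom 1 j"] j w_neq_0 by (simp add: degree_monom_eq)
    with \<open>\<not> degree g \<le> m\<close> show False by simp
  qed
  \<comment> \<open>Testing against the monomial of degree \<open>m\<close> now determines the last
    coordinate of \<open>v\<close>.\<close>
  have "degree (g * monom 1 m) \<le> 2 * m"
    using degree_mult_le[of g "monom 1 m"] \<open>degree g \<le> m\<close> degree_monom_le[of "1::'a" m] by linarith
  then have "(\<Sum>x\<in>U. poly (g * monom 1 m) x) = - w\<^sup>2 * coeff (g * monom 1 m) (2 * m)"
    by (rule sum_poly_U)
  also have "coeff (g * monom 1 m) (2 * m) = coeff g m"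
    by (subst mult.commute, subst coeff_monom_mult) simp
  finally have "w * (v $ Suc (2 * m) - w * coeff g m) = 0"
    using key[of "monom 1 m"] by (simp add: degree_monom_eq power2_eq_square algebra_simps)
  then have "v $ Suc (2 * m) = w * coeff g m" using w_neq_0 by simp
  then have "v = codeword g"
    using dim by (intro eq_vecI) (auto simp: codeword_def poly_g less_Suc_eq)
  with \<open>degree g \<le> m\<close> show ?thesis by (auto simp: code_def)
qed

lemma self_dual_code: "self_dual_code (2 * m + 2) code"
  unfolding self_dual_code_def vec_module.orthogonal_complement_def
proof (intro equalityI subsetI)
  fix v assume "v \<in> {x \<in> carrier_vec (2 * m + 2). \<forall>y\<in>code. x \<bullet> y = 0}"
  then show "v \<in> code"
    by (intro orthogonal_in_code) (auto simp: code_def)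
next
  fix v assume "v \<in> code"
  then show "v \<in> {x \<in> carrier_vec (2 * m + 2). \<forall>y\<in>code. x \<bullet> y = 0}"
    by (auto simp: code_def code_self_orthogonal) (simp add: codeword_def)
qed

section \<open>Minimum distance\<close>

text \<open>Agreements at evaluation points are roots of \<open>f - g\<close>. Agreement in the last
  coordinate as well forces the coefficient at \<open>m\<close> to vanish, which lowers the degree
  and so costs at least one possible root.\<close>

lemma card_agreement:
  assumes "degree f \<le> m" "degree g \<le> m" "f \<noteq> g"
  shows "card {i. i < 2 * m + 2 \<and> codeword f $ i = codeword g $ i} \<le> m"
proof -
  define h where "h = f - g"
  have h: "degree h \<le> m" "h \<noteq> 0" using assms by (auto simp: h_def intro: degree_diff_le)
  let ?E = "{i. i < Suc (2 * m) \<and> poly h (a i) = 0}"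
  have "card ?E = card (a ` ?E)"
    using a_eq_iff by (intro card_image[symmetric]) (auto simp: inj_on_def)
  also have "\<dots> \<le> card {x. poly h x = 0}"
    using h by (intro card_mono poly_roots_finite) auto
  also have "\<dots> \<le> degree h" using h by (intro card_poly_roots_bound)
  finally have E: "card ?E \<le> degree h" .
  have sub: "{i. i < 2 * m + 2 \<and> codeword f $ i = codeword g $ i}
      \<subseteq> ?E \<union> (if coeff h m = 0 then {Suc (2 * m)} else {})"
    using w_neq_0 by (auto simp: codeword_def h_def less_Suc_eq split: if_splits)
  show ?thesis
  proof (cases "coeff h m = 0")
    case True
    with h have "degree h < m" by (metis le_neq_implies_less leading_coeff_0_iff)
    with E True sub card_mono[OF _ sub] card_Un_le[of ?E "{Suc (2 * m)}"]
    show ?thesis by simp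
  next
    case False
    with E h sub card_mono[OF _ sub] show ?thesis by simp
  qed
qed

lemma hamming_dist_codeword:
  "hamming_dist (codeword f) (codeword g)
    = 2 * m + 2 - card {i. i < 2 * m + 2 \<and> codeword f $ i = codeword g $ i}"
proof -
  let ?E = "{i. i < 2 * m + 2 \<and> codeword f $ i = codeword g $ i}"
  have "hamming_dist (codeword f) (codeword g) = card ({..<2 * m + 2} - ?E)"
    unfolding hamming_dist_def by (intro arg_cong[of _ _ card]) (auto simp: codeword_def)
  also have "\<dots> = 2 * m + 2 - card ?E"
    by (subst card_Diff_subset) auto
  finally show ?thesis .
qed

text \<open>Equal codewords agree in all \<open>2 * m + 2\<close> positions, more than
  \<open>card_agreement\<close> allows for distinct polynomials.\<close>

lemma codeword_eq_iff:
  assumes "degree f \<le> m" "degree g \<le> m"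
  shows "codeword f = codeword g \<longleftrightarrow> f = g"
proof
  assume "codeword f = codeword g"
  show "f = g"
  proof (rule ccontr)
    assume "f \<noteq> g"
    from card_agreement[OF assms this] show False by (simp add: \<open>codeword f = codeword g\<close>)
  qed
qed simp

lemma min_dist_code: "min_dist code = m + 2"
  unfolding min_dist_def
proof (rule Min_eqI)
  let ?D = "{hamming_dist x y |x y. x \<in> code \<and> y \<in> code \<and> x \<noteq> y}"
  have "?D \<subseteq> {..2 * m + 2}"
    by (auto simp: code_def hamming_dist_codeword)
  then show "finite ?D" by (rule finite_subset) simp
  show "m + 2 \<le> d" if "d \<in> ?D" for d
  proof -
    from that obtain f g where fg: "degree f \<le> m" "degree g \<le> m" "codeword f \<noteq> codeword g"
      "d = hamming_dist (codeword f) (codeword g)"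
      by (auto simp: code_def)
    then have "card {i. i < 2 * m + 2 \<and> codeword f $ i = codeword g $ i} \<le> m"
      by (intro card_agreement) auto
    with fg(4) show ?thesis unfolding hamming_dist_codeword by linarith
  qed
  \<comment> \<open>This polynomial of degree \<open>m\<close> vanishes at the first
    \<open>m\<close> evaluation points, so its codeword meets the zero codeword in the maximal
    number \<open>m\<close> of positions and the bound is attained.\<close>
  define f where "f = (\<Prod>x\<in>a ` {..<m}. [:-x, 1:])"
  have card: "card (a ` {..<m}) = m"
    using a_eq_iff by (subst card_image) (auto simp: inj_on_def)
  then have f: "degree f \<le> m" "f \<noteq> 0"
    using coeff_prod_linear_card[of "a ` {..<m}"]
    by (auto simp: f_def degree_prod_linear)
  have z: "codeword f $ i = codeword 0 $ i" if "i < m" for i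
    using that by (auto simp: codeword_def f_def poly_prod)
  have "card {..<m} \<le> card {i. i < 2 * m + 2 \<and> codeword f $ i = codeword 0 $ i}"
    using z by (intro card_mono) auto
  with card_agreement[of f 0] f have "m + 2 = hamming_dist (codeword f) (codeword 0)"
    by (simp add: hamming_dist_codeword)
  moreover have "codeword f \<noteq> codeword 0" using f codeword_eq_iff[of f 0] by simp
  ultimately show "m + 2 \<in> ?D" using f by (force simp: code_def)
qed

section \<open>Linearity and dimension\<close>

text \<open>Messages are coefficient vectors rather than polynomials, so that the encoder is a
  linear map between the spaces \<open>module_vec\<close> and its image has a computable
  dimension.\<close>

definition encode :: "'a vec \<Rightarrow> 'a vec" where
  "encode v = codeword (\<Sum>i<Suc m. monom (v $ i) i)"

lemma degree_message: "degree (\<Sum>i<Suc m. monom (v i) i) \<le> m"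
  by (intro degree_sum_le) (auto intro: order.trans[OF degree_monom_le])

lemma coeff_message: "j < Suc m \<Longrightarrow> coeff (\<Sum>i<Suc m. monom (v i) i) j = v j"
  by (simp only: coeff_sum coeff_monom sum.delta' finite_lessThan lessThan_iff if_True
        eq_commute[of _ j] cong: if_cong)

lemma code_eq_encode: "code = encode ` carrier_vec (Suc m)"
proof (intro equalityI subsetI)
  fix v assume "v \<in> code"
  then obtain f where f: "degree f \<le> m" "v = codeword f" by (auto simp: code_def)
  have "(\<Sum>i<Suc m. monom (vec (Suc m) (coeff f) $ i) i) = (\<Sum>i\<le>m. monom (coeff f i) i)"
    by (intro sum.cong) auto
  also have "\<dots> = f" using f(1) by (rule poly_as_sum_of_monoms')
  finally have "v = encode (vec (Suc m) (coeff f))" by (simp add: encode_def f)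
  then show "v \<in> encode ` carrier_vec (Suc m)" by auto
qed (use degree_message in \<open>auto simp: code_def encode_def\<close>)

lemma inj_encode: "inj_on encode (carrier_vec (Suc m))"
proof (rule inj_onI)
  fix u v :: "'a vec"
  assume uv: "u \<in> carrier_vec (Suc m)" "v \<in> carrier_vec (Suc m)" "encode u = encode v"
  then have eq: "(\<Sum>i<Suc m. monom (u $ i) i) = (\<Sum>i<Suc m. monom (v $ i) i)"
    by (simp only: encode_def codeword_eq_iff degree_message)
  have "u $ j = v $ j" if "j < Suc m" for j
    using arg_cong[OF eq, of "\<lambda>f. coeff f j"] by (simp only: coeff_message that)
  with uv show "u = v" by (intro eq_vecI) auto
qed

lemma linear_map_encode:
  "linear_map class_ring (module_vec TYPE('a) (Suc m)) (module_vec TYPE('a) (2 * m + 2)) encode"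
proof -
  have add: "encode (u + v) = encode u + encode v"
    if "u \<in> carrier_vec (Suc m)" "v \<in> carrier_vec (Suc m)" for u v
  proof -
    have "(\<Sum>i<Suc m. monom ((u + v) $ i) i) =
        (\<Sum>i<Suc m. monom (u $ i) i) + (\<Sum>i<Suc m. monom (v $ i) i)"
      using that by (subst sum.distrib[symmetric]) (intro sum.cong, auto simp: add_monom)
    then show ?thesis
      unfolding encode_def by (intro eq_vecI) (auto simp: codeword_def ring_distribs)
  qed
  have smult: "encode (c \<cdot>\<^sub>v v) = c \<cdot>\<^sub>v encode v" if "v \<in> carrier_vec (Suc m)" for c v
  proof -
    have "Polynomial.smult c (\<Sum>i<Suc m. monom (v $ i) i)
        = (\<Sum>i<Suc m. Polynomial.smult c (monom (v $ i) i))"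
      by (rule sum_comp_morphism[symmetric, unfolded o_def]) (simp_all add: smult_add_right)
    also have "\<dots> = (\<Sum>i<Suc m. monom ((c \<cdot>\<^sub>v v) $ i) i)"
      using that by (intro sum.cong) (auto simp: smult_monom)
    finally have "(\<Sum>i<Suc m. monom ((c \<cdot>\<^sub>v v) $ i) i)
        = Polynomial.smult c (\<Sum>i<Suc m. monom (v $ i) i)" ..
    then show ?thesis
      unfolding encode_def by (intro eq_vecI) (auto simp: codeword_def)
  qed
  have closed: "encode v \<in> carrier_vec (2 * m + 2)" for v
    by (simp add: encode_def codeword_def)
  have "encode \<in> LinearCombinations.module_hom class_ring
      (module_vec TYPE('a) (Suc m)) (module_vec TYPE('a) (2 * m + 2))"
    unfolding LinearCombinations.module_hom_def module_vec_simps class_ring_simps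
    using closed add smult by blast
  then show ?thesis
    by (intro linear_map.intro mod_hom.intro mod_hom_axioms.intro vec_vs vec_module)
qed

lemma mds_code: "mds_code (2 * m + 2) code"
proof -
  have "codeword 1 \<noteq> codeword 0" using codeword_eq_iff[of 1 0] by simp
  then have "\<exists>x\<in>code. \<exists>y\<in>code. x \<noteq> y" unfolding code_def by force
  with subspace_and_dim_image[OF linear_map_encode inj_encode] min_dist_code
  have "linear_code (2 * m + 2) (Suc m) (m + 2) code"
    by (simp add: linear_code_def code_eq_encode)
  \<comment> \<open>The parameters satisfy \<open>Suc m + (m + 2) = (2 * m + 2) + 1\<close>.\<close>
  then show ?thesis unfolding mds_code_def by (intro exI conjI) auto
qed

end

section \<open>Evaluation at an additive subgroup\<close>

text \<open>The map sending \<open>y\<close> to \<open>x - y\<close> is its own inverse and carries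
  \<open>U - {x}\<close> onto \<open>U - {0}\<close>.\<close>

lemma additive_subgroup_diff_prod:
  fixes U :: "'a::field set"
  assumes "\<And>x y. x \<in> U \<Longrightarrow> y \<in> U \<Longrightarrow> x - y \<in> U" and "x \<in> U"
  shows "(\<Prod>y\<in>U-{x}. x - y) = \<Prod>(U - {0})"
proof -
  have "x - (x - y) \<in> U" if "y \<in> U" for y using that assms by blast
  then have "bij_betw (\<lambda>y. x - y) (U - {x}) (U - {0})"
    using assms by (intro bij_betw_byWitness[where f' = "\<lambda>y. x - y"]) auto
  then show ?thesis by (rule prod.reindex_bij_betw)
qed

theorem theorem4:
  fixes p s e :: nat
  assumes "prime p" and "odd p"
    and "s > 0"
    and "CARD('a::{field,finite}) = p ^ (2 * s)"
    and "1 \<le> e" and "e \<le> s"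
  shows "\<exists>C :: 'a vec set.
           mds_code (p ^ (2 * e) + 1) C \<and> self_dual_code (p ^ (2 * e) + 1) C"
proof -
  \<comment> \<open>The field order is the square of the odd number \<open>p ^ s\<close>, hence 1
    modulo 4.\<close>
  obtain r where r: "p ^ s = 2 * r + 1" using assms(2) by (metis even_power oddE)
  have "CARD('a) = 4 * (r * r + r) + 1"
    using assms(4) r by (simp add: power_mult power2_eq_square mult.commute[of 2 s] algebra_simps)
  then have mod4: "CARD('a) mod 4 = 1" by presburger
  then have two: "(2::'a) \<noteq> 0"
    by (intro two_neq_0_if_odd_CARD) presburger
  obtain i :: 'a where i: "i\<^sup>2 = -1" using ex_sqrt_minus_one[OF mod4] by blast
  obtain U :: "'a set" where U: "\<And>x y. x \<in> U \<Longrightarrow> y \<in> U \<Longrightarrow> x - y \<in> U" "card U = p ^ (2 * e)"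
    using ex_additive_subgroup[OF assms(1,4), of "2 * e"] assms(6) by auto
  have "odd (p ^ (2 * e))" using assms(2) by simp
  then obtain m where m: "p ^ (2 * e) = Suc (2 * m)" by (metis oddE Suc_eq_plus1)
  have zero: "0 \<in> U" using U m by (metis card.empty diff_self ex_in_conv nat.distinct(1))
  have "-x \<in> U - {0}" if "x \<in> U - {0}" for x
    using U(1)[OF zero, of x] that by auto
  then obtain v where v: "v\<^sup>2 = \<Prod>(U - {0})"
    using prod_symmetric_set_is_square[OF two i, of "U - {0}"] by auto
  obtain a where "bij_betw a {0..<card U} U"
    using ex_bij_betw_nat_finite[of U] by auto
  then have bij: "bij_betw a {..<Suc (2 * m)} U"
    using U(2) m by (simp add: atLeast0LessThan)
  \<comment> \<open>The factor \<open>i\<close> supplies the sign: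
    \<open>- (i * v)\<^sup>2 = v\<^sup>2\<close>, the product of the nonzero elements of
    \<open>U\<close>.\<close>
  interpret extended_rs U a m "i * v"
    using bij additive_subgroup_diff_prod[OF U(1)] v i
    by unfold_locales (simp_all add: power_mult_distrib)
  have "p ^ (2 * e) + 1 = 2 * m + 2" using m by simp
  then show ?thesis using mds_code self_dual_code by auto
qed

end
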